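(* Let $X$ be a geodesic metric space which is Gromov hyperbolic. If $X$ has asymptotic dimension one, then $X$ is quasi-isometric to an unbounded tree.
   Context: The space $X$ is not assumed to be proper. Asymptotic dimension: let $X$ be a metric space and $X=\bigcup_i O_i$ a covering. For $D\ge 0$, the \emph{$D$-multiplicity} of the covering is at most $n$ if for every $x\in X$ the closed $D$-ball centered at $x$ intersects at most $n$ elements of $\{O_i\}_i$. The asymptotic dimension of $X$ is at most $n$ if for every $D\ge 0$ there exists a covering $X=\bigcup_i O_i$ such that the diameters of the $O_i$ are uniformly bounded (there is $C$ with $\operatorname{diam} O_i\le C$ for all $i$) and the $D$-multiplicity of the covering is at most $n+1$. The asymptotic dimension of $X$ is $n$ if it is at most $n$ but not at most $n-1$; it is infinite if no such $n$ exists. A tree is regarded as a metric space with its path metric. *)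

theory Defs
  imports "HOL-Analysis.Abstract_Metric_Spaces"
begin

text \<open>Metric spaces are given by a carrier and a distance function, as in the library locale
  \<^locale>\<open>Metric_space\<close>.\<close>

definition geodesic_space :: "'a set \<Rightarrow> ('a \<Rightarrow> 'a \<Rightarrow> real) \<Rightarrow> bool" where
  "geodesic_space M d \<longleftrightarrow>
     (\<forall>x\<in>M. \<forall>y\<in>M. \<exists>\<gamma>.
        \<gamma> 0 = x \<and> \<gamma> (d x y) = y \<and> \<gamma> ` {0..d x y} \<subseteq> M \<and>
        (\<forall>s\<in>{0..d x y}. \<forall>t\<in>{0..d x y}. d (\<gamma> s) (\<gamma> t) = \<bar>s - t\<bar>))"

definition gromov_product :: "('a \<Rightarrow> 'a \<Rightarrow> real) \<Rightarrow> 'a \<Rightarrow> 'a \<Rightarrow> 'a \<Rightarrow> real" where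
  "gromov_product d w x y = (d x w + d y w - d x y) / 2"

definition gromov_hyperbolic :: "'a set \<Rightarrow> ('a \<Rightarrow> 'a \<Rightarrow> real) \<Rightarrow> bool" where
  "gromov_hyperbolic M d \<longleftrightarrow>
     (\<exists>\<delta>\<ge>0. \<forall>w\<in>M. \<forall>x\<in>M. \<forall>y\<in>M. \<forall>z\<in>M.
        gromov_product d w x z \<ge> min (gromov_product d w x y) (gromov_product d w y z) - \<delta>)"

text \<open>Finiteness is required separately because \<^const>\<open>card\<close> is 0 on infinite sets.\<close>

definition multiplicity_at_most ::
    "'a set \<Rightarrow> ('a \<Rightarrow> 'a \<Rightarrow> real) \<Rightarrow> real \<Rightarrow> 'a set set \<Rightarrow> int \<Rightarrow> bool" where
  "multiplicity_at_most M d D \<O> n \<longleftrightarrow>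
     (\<forall>x\<in>M. finite {U \<in> \<O>. Metric_space.mcball M d x D \<inter> U \<noteq> {}} \<and>
            int (card {U \<in> \<O>. Metric_space.mcball M d x D \<inter> U \<noteq> {}}) \<le> n)"

text \<open>The bound is an integer so that ``not at most \<open>n - 1\<close>'' is literally meaningful
  for \<open>n = 0\<close>.\<close>

definition asdim_at_most :: "'a set \<Rightarrow> ('a \<Rightarrow> 'a \<Rightarrow> real) \<Rightarrow> int \<Rightarrow> bool" where
  "asdim_at_most M d n \<longleftrightarrow>
     (\<forall>D\<ge>0. \<exists>\<O>. \<Union>\<O> = M \<and>
        (\<exists>C. \<forall>U\<in>\<O>. \<forall>x\<in>U. \<forall>y\<in>U. d x y \<le> C) \<and>
        multiplicity_at_most M d D \<O> (n + 1))"

definition has_asdim :: "'a set \<Rightarrow> ('a \<Rightarrow> 'a \<Rightarrow> real) \<Rightarrow> nat \<Rightarrow> bool" where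
  "has_asdim M d n \<longleftrightarrow> asdim_at_most M d (int n) \<and> \<not> asdim_at_most M d (int n - 1)"

definition quasi_isometric ::
    "'a set \<Rightarrow> ('a \<Rightarrow> 'a \<Rightarrow> real) \<Rightarrow> 'b set \<Rightarrow> ('b \<Rightarrow> 'b \<Rightarrow> real) \<Rightarrow> bool" where
  "quasi_isometric M d N e \<longleftrightarrow>
     (\<exists>f K C. f ` M \<subseteq> N \<and> K \<ge> 1 \<and> C \<ge> 0 \<and>
        (\<forall>x\<in>M. \<forall>y\<in>M. d x y / K - C \<le> e (f x) (f y) \<and> e (f x) (f y) \<le> K * d x y + C) \<and>
        (\<forall>z\<in>N. \<exists>x\<in>M. e (f x) z \<le> C))"

text \<open>A tree is a non-empty connected simple graph without cycles; it may be infinite, with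
  vertices of infinite degree.\<close>

definition graph_tree :: "'v set \<Rightarrow> 'v set set \<Rightarrow> bool" where
  "graph_tree V E \<longleftrightarrow>
     V \<noteq> {} \<and>
     (\<forall>e\<in>E. e \<subseteq> V \<and> card e = 2) \<and>
     (\<forall>u\<in>V. \<forall>v\<in>V. \<exists>p. p \<noteq> [] \<and> hd p = u \<and> last p = v \<and> successively (\<lambda>a b. {a, b} \<in> E) p) \<and>
     \<not> (\<exists>p. length p \<ge> 3 \<and> distinct p \<and> successively (\<lambda>a b. {a, b} \<in> E) p \<and> {last p, hd p} \<in> E)"

text \<open>The metric space is the geometric realization, in which every edge is a segment of
  length 1.  Its points are given by barycentric coordinates: functions on the vertices that are
  supported on a single vertex or on an edge, with non-negative values adding up to 1.\<close>

definition cell :: "'v set \<Rightarrow> ('v \<Rightarrow> real) set" where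
  "cell \<sigma> = {x. (\<forall>v. x v \<ge> 0) \<and> (\<forall>v. v \<notin> \<sigma> \<longrightarrow> x v = 0) \<and> sum x \<sigma> = 1}"

definition realization :: "'v set \<Rightarrow> 'v set set \<Rightarrow> ('v \<Rightarrow> real) set" where
  "realization V E = (\<Union>v\<in>V. cell {v}) \<union> (\<Union>e\<in>E. cell e)"

text \<open>\<open>path_length V E x y l\<close>: there is a piecewise linear path of length \<open>l\<close> from \<open>x\<close> to \<open>y\<close>
  in the realization.  Two points \<open>y\<close> and \<open>z\<close> of the closed edge \<open>{u, v}\<close> satisfy
  \<open>y u + y v = z u + z v = 1\<close>, so their distance along this edge can be read off either
  coordinate.\<close>

inductive path_length :: "'v set \<Rightarrow> 'v set set \<Rightarrow> ('v \<Rightarrow> real) \<Rightarrow> ('v \<Rightarrow> real) \<Rightarrow> real \<Rightarrow> bool"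
  for V :: "'v set" and E :: "'v set set" where
  trivial: "x \<in> realization V E \<Longrightarrow> path_length V E x x 0"
| append: "path_length V E x y l \<Longrightarrow> e \<in> E \<Longrightarrow> y \<in> cell e \<Longrightarrow> z \<in> cell e \<Longrightarrow> v \<in> e \<Longrightarrow>
     path_length V E x z (l + \<bar>y v - z v\<bar>)"

text \<open>The value off the realization is arbitrary; 0 is chosen since \<^locale>\<open>Metric_space\<close> asks for
  a function that is non-negative and symmetric everywhere.\<close>

definition path_metric :: "'v set \<Rightarrow> 'v set set \<Rightarrow> ('v \<Rightarrow> real) \<Rightarrow> ('v \<Rightarrow> real) \<Rightarrow> real" where
  "path_metric V E x y =
     (if x \<in> realization V E \<and> y \<in> realization V E then Inf {l. path_length V E x y l} else 0)"

lemma path_length_in_realization: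
  assumes "path_length V E x y l" shows "x \<in> realization V E" "y \<in> realization V E"
  using assms by (induction) (auto simp: realization_def)

lemma cell_edge_coord:
  assumes "card e = 2" "y \<in> cell e" "z \<in> cell e" "v \<in> e"
  shows "\<bar>y w - z w\<bar> \<le> \<bar>y v - z v\<bar>" 
proof -
  obtain a b where e: "e = {a, b}" "a \<noteq> b" using assms(1) by (auto simp: card_2_iff)
  have "y a + y b = 1" "z a + z b = 1" using assms(2,3) e by (auto simp: cell_def)
  moreover have "w \<notin> e \<Longrightarrow> y w = 0 \<and> z w = 0" using assms(2,3) by (auto simp: cell_def)
  ultimately show ?thesis using assms(4) e by (cases "w \<in> e") auto
qed

lemma path_length_coord:
  assumes "graph_tree V E" "path_length V E x y l"
  shows "\<bar>x w - y w\<bar> \<le> l"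
  using assms(2)
proof (induction)
  case (append x y l e z v)
  then have "\<bar>y w - z w\<bar> \<le> \<bar>y v - z v\<bar>"
    using assms(1) by (intro cell_edge_coord[of e]) (auto simp: graph_tree_def)
  then show ?case using append.IH by linarith
qed auto

lemma path_length_trans:
  assumes "path_length V E y z m" "path_length V E x y l"
  shows "path_length V E x z (l + m)"
  using assms
proof (induction)
  case (append y y' m e z v)
  then show ?case using path_length.append[of V E x y' "l + m" e z v] by (simp add: add.assoc)
qed auto

lemma path_length_edge:
  assumes "e \<in> E" "y \<in> cell e" "z \<in> cell e" "v \<in> e"
  shows "path_length V E y z \<bar>y v - z v\<bar>"
  using path_length.append[OF path_length.trivial, of y V E e z v] assms
  by (auto simp: realization_def)

lemma path_length_sym:
  assumes "path_length V E x y l" shows "path_length V E y x l"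
  using assms
proof (induction)
  case (append x y l e z v)
  have "path_length V E z y \<bar>z v - y v\<bar>" using append by (intro path_length_edge)
  from path_length_trans[OF append.IH this] show ?case
    by (simp add: abs_minus_commute add.commute)
qed (rule path_length.trivial)

lemma path_length_vertices:
  assumes "graph_tree V E" "successively (\<lambda>a b. {a, b} \<in> E) p" "p \<noteq> []" "hd p \<in> V"
  shows "\<exists>l. path_length V E (indicator {hd p}) (indicator {last p}) l"
  using assms(2-)
proof (induction p rule: induct_list012)
  case (2 a)
  then have "indicator {a} \<in> realization V E"
    by (auto simp: realization_def cell_def intro!: bexI[of _ a])
  then show ?case by (auto intro: path_length.trivial)
next
  case (3 a b p)
  then have ab: "{a, b} \<in> E" "b \<in> V" "a \<noteq> b" using assms(1) by (auto simp: graph_tree_def)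
  then obtain l where l: "path_length V E (indicator {b}) (indicator {last (b # p)}) l"
    using 3 by auto
  have "path_length V E (indicator {a}) (indicator {b}) \<bar>indicator {a} a - indicator {b} a\<bar>"
    using ab by (intro path_length_edge[of "{a, b}"]) (auto simp: cell_def indicator_def)
  from path_length_trans[OF l this] show ?case by auto
qed auto

lemma path_length_to_vertex:
  assumes "graph_tree V E" "x \<in> realization V E"
  shows "\<exists>v\<in>V. \<exists>l. path_length V E x (indicator {v}) l"
proof -
  consider v where "v \<in> V" "x \<in> cell {v}" | e where "e \<in> E" "x \<in> cell e"
    using assms(2) by (auto simp: realization_def)
  then show ?thesis
  proof cases
    case 1
    then have "x = indicator {v}" by (auto simp: cell_def indicator_def fun_eq_iff)
    then show ?thesis using 1 assms(2) by (metis path_length.trivial)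
  next
    case 2
    then obtain a b where e: "e = {a, b}" "a \<noteq> b" "a \<in> V"
      using assms(1) by (fastforce simp: graph_tree_def card_2_iff)
    then have "path_length V E x (indicator {a}) \<bar>x a - indicator {a} a\<bar>"
      using 2 by (intro path_length_edge[of e]) (auto simp: cell_def indicator_def)
    then show ?thesis using e by blast
  qed
qed

lemma path_length_exists:
  assumes "graph_tree V E" "x \<in> realization V E" "y \<in> realization V E"
  shows "\<exists>l. path_length V E x y l"
proof -
  obtain u l where u: "u \<in> V" "path_length V E x (indicator {u}) l"
    using path_length_to_vertex assms by blast
  obtain v m where v: "v \<in> V" "path_length V E y (indicator {v}) m"
    using path_length_to_vertex assms by blast
  obtain p where p: "p \<noteq> []" "hd p = u" "last p = v" "successively (\<lambda>a b. {a, b} \<in> E) p"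
    using assms(1) u(1) v(1) unfolding graph_tree_def by blast
  obtain k where k: "path_length V E (indicator {u}) (indicator {v}) k"
    using path_length_vertices[OF assms(1) p(4,1)] p u by auto
  show ?thesis
    using path_length_trans[OF path_length_sym[OF v(2)] path_length_trans[OF k u(2)]] by blast
qed

theorem Metric_space_path_metric:
  assumes T: "graph_tree V E"
  shows "Metric_space (realization V E) (path_metric V E)"
proof
  let ?L = "\<lambda>x y. {l. path_length V E x y l}"
  have nonneg: "0 \<le> l" if "path_length V E x y l" for x y l
    using path_length_coord[OF T that, of undefined] by linarith
  have bdd: "bdd_below (?L x y)" for x y
    using nonneg by (auto intro!: bdd_belowI[of _ 0])
  have ne: "?L x y \<noteq> {}" if "x \<in> realization V E" "y \<in> realization V E" for x y
    using path_length_exists[OF T that] by auto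
  have pm: "path_metric V E x y = Inf (?L x y)" if "x \<in> realization V E" "y \<in> realization V E" for x y
    using that by (simp add: path_metric_def)
  show "0 \<le> path_metric V E x y" for x y
  proof (cases "x \<in> realization V E \<and> y \<in> realization V E")
    case True
    then show ?thesis
      using ne[of x y] nonneg by (auto simp: pm intro!: cInf_greatest)
  qed (auto simp: path_metric_def)
  show "path_metric V E x y = path_metric V E y x" for x y
  proof -
    have "?L x y = ?L y x" using path_length_sym by blast
    then show ?thesis by (auto simp: path_metric_def)
  qed
  show "path_metric V E x y = 0 \<longleftrightarrow> x = y"
    if xy: "x \<in> realization V E" "y \<in> realization V E" for x y
  proof
    assume 0: "path_metric V E x y = 0"
    have "\<bar>x w - y w\<bar> \<le> 0" for w
      unfolding 0[symmetric] pm[OF xy]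
      using ne[OF xy] path_length_coord[OF T] by (intro cInf_greatest) auto
    then show "x = y" by (auto simp: fun_eq_iff)
  next
    assume "x = y"
    then have "0 \<in> ?L x y" using xy by (auto intro: path_length.trivial)
    then show "path_metric V E x y = 0"
      unfolding pm[OF xy] by (intro cInf_eq_minimum) (auto intro: nonneg)
  qed
  show "path_metric V E x z \<le> path_metric V E x y + path_metric V E y z"
    if x: "x \<in> realization V E" and y: "y \<in> realization V E" and z: "z \<in> realization V E" for x y z
  proof -
    have "path_metric V E x z - m \<le> path_metric V E x y" if m: "m \<in> ?L y z" for m
      unfolding pm[OF x y]
    proof (rule cInf_greatest[OF ne[OF x y]])
      fix l assume "l \<in> ?L x y"
      then have "l + m \<in> ?L x z" using m path_length_trans[of V E y z m x l] by blast
      then have "path_metric V E x z \<le> l + m"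
        unfolding pm[OF x z] by (intro cInf_lower bdd)
      then show "path_metric V E x z - m \<le> l" by simp
    qed
    then have "path_metric V E x z - path_metric V E x y \<le> path_metric V E y z"
      unfolding pm[OF y z] by (intro cInf_greatest[OF ne[OF y z]]) force
    then show ?thesis by simp
  qed
qed

end

theory Submission imports Defs "HOL-Library.Sublist"
begin

text \<open>Cover \<open>X\<close> by uniformly bounded sets such that every ball of radius \<open>2 r\<close> meets at most two of
  them, with \<open>r\<close> large compared to the hyperbolicity constant, and colour every point by a set
  containing it. Points at distance at most \<open>2 r\<close> have colours that are equal or adjacent in the
  nerve, and small triangles have degenerate images. Since the Rips complex of a hyperbolic
  geodesic space is simply connected, the colouring lifts to the universal cover of the nerve,
  which is a tree. Concretely, \<open>x\<close> is sent to the reduced edge path of the colours along a chain of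
  steps of length \<open>r\<close> towards a base point. The lift is coarsely Lipschitz; points with the same
  image have the same colour and points with adjacent images have adjacent colours, so it is a
  quasi-isometry onto its image, a subtree. If this were bounded, then so would be \<open>X\<close>, and \<open>X\<close>
  would have asymptotic dimension at most 0.\<close>

subsection \<open>Trees and their path metric\<close>

text \<open>Following parents downwards connects every vertex to the base. On a cycle, a vertex of
  maximal height would have both of its neighbours equal to its parent.\<close>

lemma graph_tree_of_parent:
  fixes height :: "'v \<Rightarrow> nat"
  assumes base: "base \<in> V"
    and parent: "\<And>v. v \<in> V \<Longrightarrow> v \<noteq> base \<Longrightarrow> parent v \<in> V \<and> height v = Suc (height (parent v))"
  shows "graph_tree V {{v, parent v} | v. v \<in> V \<and> v \<noteq> base}"
proof -
  define E where "E = {{v, parent v} | v. v \<in> V \<and> v \<noteq> base}"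
  have E_sub: "e \<subseteq> V \<and> card e = 2" if e: "e \<in> E" for e
  proof -
    obtain v where v: "e = {v, parent v}" "v \<in> V" "v \<noteq> base" using e by (auto simp: E_def)
    then have "v \<noteq> parent v" using parent[of v] by (metis n_not_Suc_n)
    then show ?thesis using v parent[of v] by auto
  qed
  \<comment> \<open>The ends of an edge differ in height by exactly one, so the end that is not
    lower is the child.\<close>
  have lower: "b = parent a" if ab: "{a, b} \<in> E" "height b \<le> height a" for a b
  proof -
    obtain v where v: "{a, b} = {v, parent v}" "v \<in> V" "v \<noteq> base" using ab(1) by (auto simp: E_def)
    then show ?thesis using parent[of v] ab(2) by (auto simp: doubleton_eq_iff)
  qed
  let ?walk = "\<lambda>u v p. p \<noteq> [] \<and> hd p = u \<and> last p = v \<and> successively (\<lambda>a b. {a, b} \<in> E) p"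
  have to_base: "\<exists>p. ?walk v base p" if "v \<in> V" for v
    using that
  proof (induction "height v" arbitrary: v rule: less_induct)
    case less
    show ?case
    proof (cases "v = base")
      case True
      then show ?thesis by (intro exI[of _ "[v]"]) auto
    next
      case False
      then obtain p where p: "?walk (parent v) base p"
        using less parent[of v] by (metis lessI)
      moreover have "{v, parent v} \<in> E" using False less by (auto simp: E_def)
      ultimately show ?thesis by (intro exI[of _ "v # p"]) (auto simp: successively_Cons)
    qed
  qed
  have conn: "\<exists>p. ?walk u v p" if uv: "u \<in> V" "v \<in> V" for u v
  proof -
    obtain p q where p: "?walk u base p" and q: "?walk v base q"
      using to_base uv by blast
    have "successively (\<lambda>a b. {b, a} \<in> E) q" using q by (simp add: insert_commute)
    then have q': "?walk base v (rev q)" using q by (simp add: hd_rev last_rev)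
    show ?thesis
    proof (cases "tl (rev q) = []")
      case True
      then have "rev q = [base]" using q' by (metis list.collapse)
      then show ?thesis using p q' by (metis last_ConsL)
    next
      case False
      then obtain b s where bs: "rev q = base # b # s" using q' by (metis list.collapse)
      then have "?walk u v (p @ b # s)"
        using p q' by (auto simp: successively_append_iff)
      then show ?thesis by blast
    qed
  qed
  have acyclic: False
    if p: "length p \<ge> 3" "distinct p" "successively (\<lambda>a b. {a, b} \<in> E) p" "{last p, hd p} \<in> E"
    for p
  proof -
    let ?n = "length p"
    \<comment> \<open>Indices are read cyclically, so that the closing edge of the cycle needs no
      separate treatment below.\<close>
    have edge: "{p ! j, p ! (Suc j mod ?n)} \<in> E" if "j < ?n" for j
    proof (cases "Suc j = ?n")
      case True
      then have "last p = p ! j" "hd p = p ! 0"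
        by (metis diff_Suc_1 last_conv_nth length_0_conv nat.distinct(1))
           (use p(1) in \<open>auto intro!: hd_conv_nth\<close>)
      then show ?thesis using p(4) True by simp
    next
      case False
      then show ?thesis using p(3) that by (simp add: successively_conv_nth)
    qed
    have "Max (height ` set p) \<in> height ` set p" using p(1) by (intro Max_in) auto
    then obtain i where i: "i < ?n" "height (p ! i) = Max (height ` set p)"
      by (auto simp: in_set_conv_nth)
    have top: "height (p ! j) \<le> height (p ! i)" if "j < ?n" for j
      using that unfolding i(2) by (intro Max_ge) auto
    \<comment> \<open>The cyclic predecessor of the highest position \<open>i\<close>.\<close>
    define j where "j = (if i = 0 then ?n - 1 else i - 1)"
    have j: "j < ?n" "Suc j mod ?n = i" using i(1) p(1) by (auto simp: j_def)
    have s: "Suc i mod ?n < ?n" using p(1) by (intro mod_less_divisor) linarith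
    have "p ! (Suc i mod ?n) = parent (p ! i)"
      using lower edge[OF i(1)] top[OF s] by blast
    moreover have "p ! j = parent (p ! i)"
      using lower[of "p ! i" "p ! j"] edge[OF j(1)] top[OF j(1)] j(2) by (simp add: insert_commute)
    ultimately have "Suc i mod ?n = j"
      using nth_eq_iff_index_eq[OF p(2) s j(1)] by simp
    \<comment> \<open>In a cycle of length at least 3 the predecessor and the successor of a
      position are different.\<close>
    then show False using p(1) i(1) by (cases "Suc i = ?n") (auto simp: j_def split: if_splits)
  qed
  show ?thesis
    unfolding graph_tree_def E_def[symmetric] using base E_sub conn acyclic by blast
qed

lemma indicator_in_realization: "v \<in> V \<Longrightarrow> indicator {v} \<in> realization V E"
  by (auto simp: realization_def cell_def intro!: bexI[of _ v])

lemma path_metric_le: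
  assumes "graph_tree V E" "path_length V E x y l"
  shows "path_metric V E x y \<le> l"
proof -
  have "0 \<le> l" if "path_length V E x y l" for l
    using path_length_coord[OF assms(1) that, of undefined] by linarith
  then have "Inf {l. path_length V E x y l} \<le> l"
    using assms(2) by (intro cInf_lower) (auto intro: bdd_belowI[of _ 0])
  then show ?thesis
    using path_length_in_realization[OF assms(2)] by (simp add: path_metric_def)
qed

lemma path_metric_edge_le:
  assumes "graph_tree V E" "{u, v} \<in> E" "x \<in> cell {u, v}"
  shows "path_metric V E (indicator {v}) x \<le> 1"
proof -
  have uv: "u \<noteq> v" using assms(1,2) by (auto simp: graph_tree_def)
  then have x: "0 \<le> x v" "x v \<le> 1" using assms(3) by (auto simp: cell_def) (smt (verit))
  have "path_length V E (indicator {v}) x \<bar>indicator {v} v - x v\<bar>"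
    using uv assms by (intro path_length_edge[of "{u, v}"]) (auto simp: cell_def indicator_def)
  then have "path_metric V E (indicator {v}) x \<le> \<bar>indicator {v} v - x v\<bar>"
    by (rule path_metric_le[OF assms(1)])
  then show ?thesis using x by simp
qed

lemma realization_near_vertex:
  assumes "graph_tree V E" "x \<in> realization V E"
  shows "\<exists>v\<in>V. path_metric V E (indicator {v}) x \<le> 1"
proof -
  consider v where "v \<in> V" "x \<in> cell {v}" | e where "e \<in> E" "x \<in> cell e"
    using assms(2) by (auto simp: realization_def)
  then show ?thesis
  proof cases
    case 1
    then have "x = indicator {v}" by (auto simp: cell_def indicator_def fun_eq_iff)
    then have "path_metric V E (indicator {v}) x \<le> 0"
      using assms path_length.trivial by (intro path_metric_le) auto
    then show ?thesis using 1 by force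
  next
    case 2
    then obtain a b where "e = {a, b}" "b \<in> V"
      using assms(1) by (fastforce simp: graph_tree_def card_2_iff)
    then show ?thesis using path_metric_edge_le[OF assms(1)] 2 by blast
  qed
qed

text \<open>A function on the vertices extends affinely over the edges, and the extension is Lipschitz
  along every piecewise linear path.\<close>

lemma vertex_function_Lipschitz:
  fixes f :: "'v \<Rightarrow> real"
  assumes T: "graph_tree V E"
    and f: "\<And>a b. {a, b} \<in> E \<Longrightarrow> f a - f b \<le> K"
    and uv: "u \<in> V" "v \<in> V"
  shows "f v - f u \<le> K * path_metric V E (indicator {u}) (indicator {v})"
proof (cases "u = v")
  case True
  interpret T: Metric_space "realization V E" "path_metric V E"
    by (rule Metric_space_path_metric[OF T])
  show ?thesis using True indicator_in_realization[OF uv(1), of E] by simp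
next
  case False
  \<comment> \<open>The affine extension of \<open>f\<close>, summed over the support of
    \<open>x\<close>, which has at most two elements on the realization.\<close>
  define g where "g x = (\<Sum>w | x w \<noteq> 0. x w * f w)" for x :: "'v \<Rightarrow> real"
  have g_edge: "g x = x a * f a + (1 - x a) * f b" if "x \<in> cell {a, b}" "a \<noteq> b" for x a b
  proof -
    have "g x = (\<Sum>w\<in>{a, b}. x w * f w)"
      unfolding g_def using that by (intro sum.mono_neutral_left) (auto simp: cell_def)
    moreover have "x b = 1 - x a" using that by (auto simp: cell_def)
    ultimately show ?thesis using that by simp
  qed
  have g_vertex: "g (indicator {w}) = f w" for w
  proof -
    have "{v. indicator {w} v \<noteq> (0::real)} = {w}" by (auto simp: indicator_def)
    then show ?thesis by (simp add: g_def)
  qed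
  have lip: "g y - g x \<le> K * l" if "path_length V E x y l" for x y l
    using that
  proof induction
    case (append x y l e z v)
    then obtain w where e: "e = {v, w}" "v \<noteq> w"
      using T by (fastforce simp: graph_tree_def card_2_iff)
    have "g z - g y = (z v - y v) * (f v - f w)"
      using append e by (simp add: g_edge algebra_simps)
    also have "\<dots> \<le> \<bar>z v - y v\<bar> * \<bar>f v - f w\<bar>" by (metis abs_ge_self abs_mult)
    also have "\<dots> \<le> \<bar>z v - y v\<bar> * K"
      using f[of v w] f[of w v] append e by (intro mult_left_mono) (auto simp: insert_commute)
    finally show ?case using append.IH by (simp add: algebra_simps abs_minus_commute)
  qed simp
  \<comment> \<open>Some edge exists because \<open>u\<close> and \<open>v\<close> differ; using the
    bound in both directions along it gives \<open>K \<ge> 0\<close>.\<close>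
  obtain a b where "{a, b} \<in> E"
  proof -
    obtain p where p: "p \<noteq> []" "hd p = u" "last p = v" "successively (\<lambda>a b. {a, b} \<in> E) p"
      using T uv unfolding graph_tree_def by blast
    then obtain a b q where "p = a # b # q" using False by (metis last_ConsL list.exhaust list.sel(1))
    then show ?thesis using p that by auto
  qed
  then have K: "K \<ge> 0" using f[of a b] f[of b a] by (auto simp: insert_commute)
  have real: "indicator {u} \<in> realization V E" "indicator {v} \<in> realization V E"
    using uv by (auto intro: indicator_in_realization)
  \<comment> \<open>The infimum is bounded after dividing by \<open>K\<close>; for
    \<open>K = 0\<close> a single path suffices.\<close>
  show ?thesis
  proof (cases "K = 0")
    case True
    obtain l where "path_length V E (indicator {u}) (indicator {v}) l"
      using path_length_exists[OF T real] by blast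
    then show ?thesis using lip True by (fastforce simp: g_vertex)
  next
    case False
    let ?L = "{l. path_length V E (indicator {u}) (indicator {v}) l}"
    have "(f v - f u) / K \<le> Inf ?L"
    proof (rule cInf_greatest)
      show "?L \<noteq> {}" using path_length_exists[OF T real] by simp
      show "(f v - f u) / K \<le> l" if "l \<in> ?L" for l
        using lip[of "indicator {u}" "indicator {v}" l] that False K by (simp add: g_vertex field_simps)
    qed
    then have "(f v - f u) / K \<le> path_metric V E (indicator {u}) (indicator {v})"
      using real by (simp add: path_metric_def)
    then show ?thesis using False K by (simp add: field_simps)
  qed
qed

subsection \<open>Reduced edge paths\<close>

text \<open>Edge paths are stored backwards, with the current endpoint at the head; \<open>push b\<close> moves the
  endpoint to \<open>b\<close> and cancels a backtracking.\<close>

fun push :: "'b \<Rightarrow> 'b list \<Rightarrow> 'b list" where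
  "push b [] = [b]"
| "push b [a] = (if b = a then [a] else [b, a])"
| "push b (a # c # l) = (if b = a then a # c # l else if b = c then c # l else b # a # c # l)"

fun reduced :: "'b list \<Rightarrow> bool" where
  "reduced (a # b # c # l) \<longleftrightarrow> a \<noteq> b \<and> a \<noteq> c \<and> reduced (b # c # l)"
| "reduced [a, b] \<longleftrightarrow> a \<noteq> b"
| "reduced l \<longleftrightarrow> True"

lemma push_cases:
  "l \<noteq> [] \<Longrightarrow> push b l = l \<or> push b l = tl l \<or> push b l = b # l"
  by (cases "(b, l)" rule: push.cases) auto

lemma push_not_Nil [simp]: "push b l \<noteq> []"
  by (cases "(b, l)" rule: push.cases) auto

lemma hd_push [simp]: "hd (push b l) = b"
  by (cases "(b, l)" rule: push.cases) auto

lemma last_push: "l \<noteq> [] \<Longrightarrow> last (push b l) = last l"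
  by (cases "(b, l)" rule: push.cases) auto

lemma push_hd: "l \<noteq> [] \<Longrightarrow> push (hd l) l = l"
  by (cases "(hd l, l)" rule: push.cases) auto

lemma reduced_push: "reduced l \<Longrightarrow> reduced (push b l)"
proof (cases "(b, l)" rule: push.cases)
  case (3 b a c m)
  moreover assume "reduced l"
  ultimately show ?thesis by (cases m) auto
qed auto

text \<open>Returning to the old endpoint undoes a move. Reducedness matters when the move itself
  cancelled an edge: this edge must then be restored, with no further cancellation.\<close>

lemma push_push_hd:
  assumes "reduced l" "l \<noteq> []"
  shows "push (hd l) (push b l) = l"
proof (cases "(b, l)" rule: push.cases)
  case (3 b a c m)
  then show ?thesis using assms by (cases m) auto
qed (use assms in auto)

text \<open>Invariance under homotopy across a degenerate triangle: the detour through
  \<open>b\<close> stands still at one of its two moves or is a backtracking.\<close>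

lemma push_triangle:
  assumes "reduced l" "l \<noteq> []" "hd l = b \<or> b = c \<or> hd l = c"
  shows "push c (push b l) = push c l"
  using assms push_hd[of "push b l"] push_push_hd[of l b] push_hd[of l] by auto

lemma successively_push:
  assumes "successively R l" "l \<noteq> []" "R b (hd l)"
  shows "successively R (push b l)"
  using assms by (cases "(b, l)" rule: push.cases) auto

lemma suffix_push:
  assumes "suffix m (push b l)" "l \<noteq> []"
  shows "m = push b l \<or> suffix m l"
  using assms by (cases "(b, l)" rule: push.cases) (auto simp: suffix_Cons split: if_splits)

subsection \<open>Lifting to the universal cover of the nerve\<close>

text \<open>Here \<open>\<pi>\<close> is one step towards the base point and \<open>\<phi>\<close>
  the colouring. Hyperbolicity enters only through \<open>\<pi>_close\<close>, and the covering only
  through \<open>two_colors\<close> and \<open>color_bounded\<close>.\<close>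

locale hyperbolic_nerve = Metric_space X d for X :: "'a set" and d +
  fixes w :: 'a and r C :: real and \<phi> :: "'a \<Rightarrow> 'b" and \<pi> :: "'a \<Rightarrow> 'a"
  assumes geodesic: "geodesic_space X d"
    and w: "w \<in> X" and r: "r > 0"
    and \<pi>_in: "x \<in> X \<Longrightarrow> \<pi> x \<in> X"
    and \<pi>_near: "x \<in> X \<Longrightarrow> d w x \<le> r \<Longrightarrow> \<pi> x = w"
    and \<pi>_far: "x \<in> X \<Longrightarrow> r < d w x \<Longrightarrow> d w (\<pi> x) = d w x - r"
    and \<pi>_step: "x \<in> X \<Longrightarrow> d x (\<pi> x) \<le> r"
    and \<pi>_close: "\<lbrakk>x \<in> X; y \<in> X; d w y \<le> d w x; d x y \<le> 2 * r\<rbrakk> \<Longrightarrow> d (\<pi> x) y \<le> 2 * r"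
    and two_colors: "\<lbrakk>x \<in> X; y \<in> X; z \<in> X; d x y \<le> 2 * r; d x z \<le> 2 * r\<rbrakk> \<Longrightarrow>
      \<phi> x = \<phi> y \<or> \<phi> y = \<phi> z \<or> \<phi> x = \<phi> z"
    and color_bounded: "\<lbrakk>x \<in> X; y \<in> X; \<phi> x = \<phi> y\<rbrakk> \<Longrightarrow> d x y \<le> C"
begin

definition steps :: "'a \<Rightarrow> nat" where "steps x = nat \<lceil>d w x / r\<rceil>"

text \<open>Since \<open>\<pi>\<close> fixes \<open>w\<close>, the recursion along the chain is
  driven by a step counter; \<open>lift_rec\<close> removes the counter again.\<close>

primrec lift_steps :: "nat \<Rightarrow> 'a \<Rightarrow> 'b list" where
  "lift_steps 0 x = [\<phi> w]"
| "lift_steps (Suc n) x = push (\<phi> x) (lift_steps n (\<pi> x))"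

definition lift :: "'a \<Rightarrow> 'b list" where "lift x = lift_steps (steps x) x"

lemma steps_0_iff:
  assumes "x \<in> X"
  shows "steps x = 0 \<longleftrightarrow> x = w"
proof -
  have "steps x = 0 \<longleftrightarrow> d w x \<le> 0" using r by (simp add: steps_def divide_le_0_iff)
  also have "\<dots> \<longleftrightarrow> x = w" using w assms nonneg[of w x] zero[of w x] by (metis antisym order_refl)
  finally show ?thesis .
qed

text \<open>A full step shortens the distance by exactly \<open>r\<close>. The last step jumps to
  \<open>w\<close> from a positive distance of at most \<open>r\<close>, where the ceiling is
  1.\<close>

lemma steps_\<pi>:
  assumes "x \<in> X" "x \<noteq> w"
  shows "steps x = Suc (steps (\<pi> x))"
proof (cases "d w x \<le> r")
  case True
  moreover have "0 < d w x" using assms w by (intro mdist_pos_less) auto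
  ultimately have "\<lceil>d w x / r\<rceil> = 1" using r by (intro ceiling_unique) auto
  then show ?thesis using True assms w by (simp add: \<pi>_near steps_def)
next
  case False
  then have "d w (\<pi> x) / r = d w x / r - 1" "d w x / r > 1"
    using \<pi>_far assms r by (auto simp: field_simps)
  then show ?thesis by (simp add: steps_def) (smt (verit) Suc_nat_eq_nat_zadd1 ceiling_less_one nat_diff_distrib one_less_ceiling)
qed

lemma lift_w: "lift w = [\<phi> w]"
  using steps_0_iff[OF w] by (simp add: lift_def)

lemma lift_rec: "x \<in> X \<Longrightarrow> x \<noteq> w \<Longrightarrow> lift x = push (\<phi> x) (lift (\<pi> x))"
  by (simp add: lift_def steps_\<pi>)

lemma X_induct [consumes 1, case_names base step]:
  assumes "x \<in> X" "P w" "\<And>x. \<lbrakk>x \<in> X; x \<noteq> w; P (\<pi> x)\<rbrakk> \<Longrightarrow> P x"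
  shows "P x"
  using assms(1)
proof (induction "steps x" arbitrary: x rule: less_induct)
  case less
  then show ?case using assms(2,3) steps_\<pi>[of x] \<pi>_in[of x] by (metis lessI)
qed

lemma lift_not_Nil: "x \<in> X \<Longrightarrow> lift x \<noteq> []"
  by (cases "x = w") (auto simp: lift_w lift_rec)

lemma hd_lift: "x \<in> X \<Longrightarrow> hd (lift x) = \<phi> x"
  by (cases "x = w") (auto simp: lift_w lift_rec)

lemma reduced_lift: "x \<in> X \<Longrightarrow> reduced (lift x)"
  by (induction rule: X_induct) (auto simp: lift_w lift_rec reduced_push)

lemma last_lift: "x \<in> X \<Longrightarrow> last (lift x) = \<phi> w"
  by (induction rule: X_induct) (auto simp: lift_w lift_rec last_push lift_not_Nil \<pi>_in)

text \<open>Adjacency of colours at the scale \<open>r\<close> of a single step of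
  \<open>\<pi>\<close>; it is what later bounds the length in \<open>X\<close> of an edge of the
  tree.\<close>

definition nerve_edge :: "'b \<Rightarrow> 'b \<Rightarrow> bool" where
  "nerve_edge a b \<longleftrightarrow> (\<exists>x\<in>X. \<exists>y\<in>X. \<phi> x = a \<and> \<phi> y = b \<and> d x y \<le> r)"

lemma successively_lift: "x \<in> X \<Longrightarrow> successively nerve_edge (lift x)"
proof (induction rule: X_induct)
  case (step x)
  have "nerve_edge (\<phi> x) (\<phi> (\<pi> x))"
    using step \<pi>_in \<pi>_step unfolding nerve_edge_def by blast
  then show ?case
    using step \<pi>_in by (simp add: lift_rec hd_lift lift_not_Nil successively_push)
qed (simp add: lift_w)

text \<open>This makes the image a subtree. Each push along the chain from \<open>w\<close> to
  \<open>x\<close> changes the path by at most one edge, so every non-empty initial part of the path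
  was itself the lift of a point of the chain.\<close>

lemma suffix_lift: "x \<in> X \<Longrightarrow> suffix m (lift x) \<Longrightarrow> m \<noteq> [] \<Longrightarrow> m \<in> lift ` X"
proof (induction rule: X_induct)
  case base
  then have "m = lift w" by (auto simp: lift_w suffix_Cons)
  then show ?case using w by blast
next
  case (step x)
  show ?case
  proof (cases "m = lift x")
    case False
    then have "suffix m (lift (\<pi> x))"
      using suffix_push[of m "\<phi> x" "lift (\<pi> x)"] step lift_not_Nil \<pi>_in by (simp add: lift_rec)
    then show ?thesis using step by blast
  qed (use step in blast)
qed

text \<open>Local consistency of the lift. The point farther from \<open>w\<close> is pulled back towards \<open>w\<close>; by
  hyperbolicity it stays close to the other one, and the triangle which it sweeps out is
  degenerate in the nerve.\<close>

lemma lift_close: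
  assumes "x \<in> X" "y \<in> X" "d x y \<le> 2 * r"
  shows "lift y = push (\<phi> y) (lift x)"
  using assms
proof (induction "steps x + steps y" arbitrary: x y rule: less_induct)
  case less
  \<comment> \<open>Undoing the move reverses the claim, so \<open>x\<close> may be taken at least
    as far from \<open>w\<close> as \<open>y\<close>.\<close>
  have cancel: "lift x = push (\<phi> x) (lift y)"
    if "lift y = push (\<phi> y) (lift x)" "x \<in> X" for x y
    using push_push_hd[OF reduced_lift[OF that(2)] lift_not_Nil[OF that(2)], of "\<phi> y"] that
    by (simp add: hd_lift)
  have wlog: "lift y = push (\<phi> y) (lift x)"
    if xy: "x \<in> X" "y \<in> X" "d x y \<le> 2 * r" "d w y \<le> d w x"
      and IH: "\<And>x' y'. \<lbrakk>steps x' + steps y' < steps x + steps y; x' \<in> X; y' \<in> X; d x' y' \<le> 2 * r\<rbrakk>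
        \<Longrightarrow> lift y' = push (\<phi> y') (lift x')" for x y
  proof (cases "x = w")
    case True
    then have "y = w" using xy w nonneg[of w y] zero[of w y] by simp
    then show ?thesis using True by (simp add: lift_w)
  next
    case False
    have \<pi>: "\<pi> x \<in> X" "d (\<pi> x) y \<le> 2 * r" using \<pi>_in \<pi>_close xy by auto
    have "lift y = push (\<phi> y) (lift (\<pi> x))"
      using IH[of "\<pi> x" y] steps_\<pi>[of x] False xy \<pi> by simp
    \<comment> \<open>Of the triangle, \<open>two_colors\<close> needs only the two sides at
      \<open>\<pi> x\<close>, of lengths at most \<open>r\<close> and \<open>2 * r\<close>.\<close>
    also have "\<dots> = push (\<phi> y) (push (\<phi> x) (lift (\<pi> x)))"
      using two_colors[of "\<pi> x" x y] \<pi> \<pi>_step[of x] xy r reduced_lift lift_not_Nil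
      by (intro push_triangle[symmetric]) (auto simp: hd_lift commute)
    finally show ?thesis using False xy by (simp add: lift_rec)
  qed
  show ?case
  proof (cases "d w y \<le> d w x")
    case True
    show ?thesis by (rule wlog[OF less.prems True less.hyps])
  next
    case False
    have "lift x = push (\<phi> x) (lift y)"
    proof (rule wlog)
      show "y \<in> X" "x \<in> X" by fact+
      show "d y x \<le> 2 * r" using less.prems(3) by (subst commute)
      show "d w x \<le> d w y" using False by simp
      show "lift y' = push (\<phi> y') (lift x')"
        if "steps x' + steps y' < steps y + steps x" "x' \<in> X" "y' \<in> X" "d x' y' \<le> 2 * r" for x' y'
        by (rule less.hyps) (use that in \<open>simp_all add: add.commute\<close>)
    qed
    then show ?thesis by (rule cancel[OF _ less.prems(2)])
  qed
qed

section \<open>The tree of lifted points\<close>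

definition rep :: "'b list \<Rightarrow> 'a" where "rep = inv_into X lift"

text \<open>Vertices are chosen points of \<open>X\<close> instead of edge paths, so that the tree
  lives on the type of \<open>X\<close>; points with the same lift share a vertex.\<close>

abbreviation vertex :: "'a \<Rightarrow> 'a" where "vertex x \<equiv> rep (lift x)"

definition V :: "'a set" where "V = vertex ` X"

definition parent :: "'a \<Rightarrow> 'a" where "parent v = rep (tl (lift v))"

definition E :: "'a set set" where "E = {{v, parent v} | v. v \<in> V \<and> v \<noteq> vertex w}"

lemma rep: "l \<in> lift ` X \<Longrightarrow> rep l \<in> X \<and> lift (rep l) = l"
  by (simp add: rep_def f_inv_into_f inv_into_into)

lemma V_D: "v \<in> V \<Longrightarrow> v \<in> X \<and> vertex v = v"
  using rep by (auto simp: V_def)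

lemma vertex_color: "x \<in> X \<Longrightarrow> \<phi> (vertex x) = \<phi> x"
  using rep[of "lift x"] by (metis hd_lift image_eqI)

lemma tl_lift:
  assumes "v \<in> V" "v \<noteq> vertex w"
  shows "tl (lift v) \<noteq> []" "tl (lift v) \<in> lift ` X" "parent v \<in> V" "lift (parent v) = tl (lift v)"
proof -
  have v: "v \<in> X" "vertex v = v" using V_D assms by auto
  show ne: "tl (lift v) \<noteq> []"
  proof
    \<comment> \<open>Every lift ends at \<open>\<phi> w\<close>, so a lift with a single entry is
      that of \<open>w\<close>.\<close>
    assume "tl (lift v) = []"
    then have "lift v = [\<phi> w]"
      using last_lift[OF v(1)] lift_not_Nil[OF v(1)] by (cases "lift v") auto
    then show False using assms v by (simp add: lift_w)
  qed
  show im: "tl (lift v) \<in> lift ` X"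
    using ne v by (intro suffix_lift[of v]) (auto simp: suffix_tl)
  show "lift (parent v) = tl (lift v)" using rep[OF im] by (simp add: parent_def)
  show "parent v \<in> V" using im by (auto simp: parent_def V_def)
qed

lemma tree: "graph_tree V E"
  unfolding E_def
proof (rule graph_tree_of_parent[where height = "\<lambda>v. length (lift v)"])
  show "vertex w \<in> V" using w by (simp add: V_def)
  show "parent v \<in> V \<and> length (lift v) = Suc (length (lift (parent v)))"
    if "v \<in> V" "v \<noteq> vertex w" for v
    using tl_lift[OF that] by (cases "lift v") auto
qed

sublocale T: Metric_space "realization V E" "path_metric V E"
  by (rule Metric_space_path_metric[OF tree])

section \<open>Comparison of the metrics of \<open>X\<close> and of the tree\<close>

abbreviation quasi_isometry :: "'a \<Rightarrow> 'a \<Rightarrow> real" where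
  "quasi_isometry x \<equiv> indicator {vertex x}"

lemma quasi_isometry_in: "x \<in> X \<Longrightarrow> quasi_isometry x \<in> realization V E"
  by (intro indicator_in_realization) (simp add: V_def)

lemma push_edge:
  assumes "x \<in> X" "y \<in> X" "lift y = \<phi> y # lift x"
  shows "{vertex x, vertex y} \<in> E"
proof -
  have y: "vertex y \<in> V" "lift (vertex y) = lift y"
    using assms(2) rep[of "lift y"] by (auto simp: V_def)
  have "lift x = tl (lift (vertex y))" using assms y by simp
  then have "vertex x = parent (vertex y)" by (simp add: parent_def)
  moreover have "vertex y \<noteq> vertex w"
  proof
    assume "vertex y = vertex w"
    then have "lift y = lift w" using y(2) w rep by (metis imageI)
    then show False using assms lift_not_Nil by (simp add: lift_w)
  qed
  ultimately show ?thesis using y unfolding E_def by (auto simp: insert_commute)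
qed

text \<open>By \<open>lift_close\<close> the lifts differ by one push, which keeps the path, drops
  its endpoint or adds one; the vertices are therefore equal or adjacent.\<close>

lemma close_le_1:
  assumes "x \<in> X" "y \<in> X" "d x y \<le> 2 * r"
  shows "path_metric V E (quasi_isometry x) (quasi_isometry y) \<le> 1"
proof -
  have edge: "path_metric V E (quasi_isometry x) (quasi_isometry y) \<le> 1"
    if "{vertex x, vertex y} \<in> E" for x y
  proof (rule path_metric_edge_le[OF tree])
    show "{vertex y, vertex x} \<in> E" using that by (simp add: insert_commute)
    have "card {vertex x, vertex y} = 2" using that tree unfolding graph_tree_def by blast
    then have "vertex x \<noteq> vertex y" by auto
    then show "quasi_isometry y \<in> cell {vertex y, vertex x}"
      by (auto simp: cell_def indicator_def)
  qed
  have xy: "lift y = push (\<phi> y) (lift x)" using lift_close assms by blast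
  show ?thesis
  using push_cases[OF lift_not_Nil[OF assms(1)], of "\<phi> y"]
  proof (elim disjE)
    assume "push (\<phi> y) (lift x) = lift x"
    then show ?thesis using xy quasi_isometry_in[OF assms(1)] by simp
  next
    assume "push (\<phi> y) (lift x) = tl (lift x)"
    then have "lift x = \<phi> x # lift y"
      using xy lift_not_Nil[OF assms(1)] hd_lift[OF assms(1)] by (metis list.collapse)
    then show ?thesis using edge push_edge assms T.commute by metis
  next
    assume "push (\<phi> y) (lift x) = \<phi> y # lift x"
    then show ?thesis using edge push_edge assms xy by metis
  qed
qed

lemma upper_bound_steps:
  assumes "x \<in> X" "y \<in> X" "d x y \<le> real n * (2 * r)"
  shows "path_metric V E (quasi_isometry x) (quasi_isometry y) \<le> n"
  using assms
proof (induction n arbitrary: y)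
  case 0
  then have "x = y" using nonneg[of x y] zero[of x y] by simp
  then show ?case using quasi_isometry_in[OF 0(1)] by simp
next
  case (Suc n)
  obtain z where z: "z \<in> X" "d x z \<le> real n * (2 * r)" "d z y \<le> 2 * r"
  proof -
    obtain \<gamma> where \<gamma>: "\<gamma> 0 = x" "\<gamma> (d x y) = y" "\<gamma> ` {0..d x y} \<subseteq> X"
      "\<forall>s\<in>{0..d x y}. \<forall>t\<in>{0..d x y}. d (\<gamma> s) (\<gamma> t) = \<bar>s - t\<bar>"
      using geodesic Suc.prems unfolding geodesic_space_def by blast
    \<comment> \<open>The point of the geodesic at distance \<open>2 * r\<close> before
      \<open>y\<close>, or \<open>x\<close> itself if the geodesic is shorter.\<close>
    define t where "t = max 0 (d x y - 2 * r)"
    have t: "t \<in> {0..d x y}" using r by (auto simp: t_def)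
    then have "\<gamma> t \<in> X" using \<gamma>(3) by blast
    moreover have "d x (\<gamma> t) = t" "d (\<gamma> t) y = d x y - t"
      using \<gamma>(4)[rule_format, of 0 t] \<gamma>(4)[rule_format, of t "d x y"] t \<gamma>(1,2) by auto
    moreover have "t \<le> real n * (2 * r)" using Suc.prems r by (auto simp: t_def algebra_simps)
    moreover have "d x y - t \<le> 2 * r" by (simp add: t_def)
    ultimately show ?thesis using that[of "\<gamma> t"] by simp
  qed
  have "path_metric V E (quasi_isometry x) (quasi_isometry y)
      \<le> path_metric V E (quasi_isometry x) (quasi_isometry z)
        + path_metric V E (quasi_isometry z) (quasi_isometry y)"
    using Suc.prems z by (intro T.triangle quasi_isometry_in)
  also have "\<dots> \<le> real n + 1"
    using Suc z close_le_1[of z y] by (intro add_mono) auto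
  finally show ?case by simp
qed

lemma upper_bound:
  assumes "x \<in> X" "y \<in> X"
  shows "path_metric V E (quasi_isometry x) (quasi_isometry y) \<le> d x y / (2 * r) + 1"
proof -
  let ?n = "nat \<lceil>d x y / (2 * r)\<rceil>"
  have "d x y / (2 * r) \<le> real ?n" by (rule real_nat_ceiling_ge)
  then have "d x y \<le> real ?n * (2 * r)" using r by (simp only: pos_divide_le_eq)
  then have "path_metric V E (quasi_isometry x) (quasi_isometry y) \<le> real ?n"
    by (rule upper_bound_steps[OF assms])
  also have "\<dots> \<le> d x y / (2 * r) + 1"
    using of_int_ceiling_le_add_one[of "d x y / (2 * r)"] r by simp
  finally show ?thesis .
qed

text \<open>The colours of a vertex and its parent are consecutive in a lift, so two points with
  these colours lie within \<open>r\<close>; each is within \<open>C\<close> of the end of the edge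
  with its colour.\<close>

lemma edge_length:
  assumes "{a, b} \<in> E"
  shows "d a b \<le> 2 * C + r"
proof -
  obtain v where v: "{a, b} = {v, parent v}" "v \<in> V" "v \<noteq> vertex w"
    using assms by (auto simp: E_def)
  note tl = tl_lift[OF v(2,3)]
  have vX: "v \<in> X" "parent v \<in> X" using V_D v(2) tl by auto
  have "lift v = \<phi> v # \<phi> (parent v) # tl (lift (parent v))"
    using tl hd_lift vX lift_not_Nil by (metis list.collapse)
  then have "nerve_edge (\<phi> v) (\<phi> (parent v))"
    using successively_lift[OF vX(1)] by (metis successively.simps(3))
  then obtain x y where xy: "x \<in> X" "y \<in> X" "\<phi> x = \<phi> v" "\<phi> y = \<phi> (parent v)" "d x y \<le> r"
    by (auto simp: nerve_edge_def)
  have "d v (parent v) \<le> d v x + d x y + d y (parent v)"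
    using triangle[of v x "parent v"] triangle[of x y "parent v"] vX xy by simp
  also have "\<dots> \<le> 2 * C + r"
    using color_bounded[of v x] color_bounded[of y "parent v"] vX xy by simp
  finally show ?thesis using v(1) by (auto simp: doubleton_eq_iff commute)
qed

text \<open>By \<open>edge_length\<close>, the distance in \<open>X\<close> from
  \<open>vertex x\<close> is a Lipschitz function on the vertices. Replacing \<open>x\<close> and
  \<open>y\<close> by their vertices, which have the same colours, costs
  \<open>2 * C\<close>.\<close>

lemma lower_bound:
  assumes "x \<in> X" "y \<in> X"
  shows "d x y \<le> (2 * C + r) * path_metric V E (quasi_isometry x) (quasi_isometry y) + 2 * C"
proof -
  have vX: "vertex x \<in> X" "vertex y \<in> X" "vertex x \<in> V" "vertex y \<in> V"
    using assms rep by (auto simp: V_def)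
  have "d (vertex x) (vertex y) - d (vertex x) (vertex x)
      \<le> (2 * C + r) * path_metric V E (quasi_isometry x) (quasi_isometry y)"
  proof (rule vertex_function_Lipschitz[OF tree])
    fix a b assume ab: "{a, b} \<in> E"
    then have "a \<in> X" "b \<in> X" using tree V_D by (auto simp: graph_tree_def)
    then show "d (vertex x) a - d (vertex x) b \<le> 2 * C + r"
      using triangle[of "vertex x" b a] edge_length[OF ab] vX by (simp add: commute)
  qed (use vX in auto)
  moreover have "d x y \<le> d x (vertex x) + d (vertex x) (vertex y) + d (vertex y) y"
    using triangle[of x "vertex x" y] triangle[of "vertex x" "vertex y" y] vX assms by simp
  moreover have "d x (vertex x) \<le> C" "d (vertex y) y \<le> C"
    using color_bounded vX assms vertex_color by auto
  ultimately show ?thesis using vX by simp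
qed

lemma C_nonneg: "C \<ge> 0"
  using color_bounded[OF w w] w by simp

lemma quasi_isometric_tree: "quasi_isometric X d (realization V E) (path_metric V E)"
proof -
  let ?e = "\<lambda>x y. path_metric V E (quasi_isometry x) (quasi_isometry y)"
  \<comment> \<open>\<open>K\<close> dominates the slopes of both bounds. The additive constant
    \<open>2 * C + 1\<close> covers \<open>2 * C\<close> from \<open>lower_bound\<close>, 1 from
    \<open>upper_bound\<close>, and the distance 1 from any point of the realization to a
    vertex.\<close>
  define K where "K = max (1 / (2 * r)) (max 1 (2 * C + r))"
  have K: "K \<ge> 1" "1 / (2 * r) \<le> K" "2 * C + r \<le> K" by (auto simp: K_def)
  show ?thesis
    unfolding quasi_isometric_def
  proof (rule exI[of _ quasi_isometry], rule exI[of _ K], rule exI[of _ "2 * C + 1"],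
      intro conjI ballI)
    show "quasi_isometry ` X \<subseteq> realization V E" using quasi_isometry_in by auto
    show "K \<ge> 1" "0 \<le> 2 * C + 1" using K C_nonneg by auto
    fix x y assume xy: "x \<in> X" "y \<in> X"
    have "d x y \<le> K * ?e x y + 2 * C"
      using lower_bound[OF xy] mult_right_mono[OF K(3) T.nonneg] by (rule order_trans[OF _ add_right_mono])
    also have "\<dots> \<le> K * (?e x y + (2 * C + 1))"
      using K(1) C_nonneg mult_right_mono[of 1 K "2 * C + 1"] by (simp add: algebra_simps)
    finally show "d x y / K - (2 * C + 1) \<le> ?e x y" using K(1) by (simp add: field_simps)
    have "d x y / (2 * r) \<le> K * d x y" using mult_right_mono[OF K(2) nonneg] by simp
    then show "?e x y \<le> K * d x y + (2 * C + 1)" using upper_bound[OF xy] C_nonneg by linarith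
  next
    fix z assume "z \<in> realization V E"
    then obtain v where v: "v \<in> V" "path_metric V E (indicator {v}) z \<le> 1"
      using realization_near_vertex[OF tree] by blast
    then show "\<exists>x\<in>X. path_metric V E (quasi_isometry x) z \<le> 2 * C + 1"
      using V_D C_nonneg by (intro bexI[of _ v]) auto
  qed
qed

lemma bounded_if_tree_bounded:
  assumes "T.mbounded (realization V E)"
  shows "\<exists>B. \<forall>x\<in>X. \<forall>y\<in>X. d x y \<le> B"
proof -
  obtain B where B: "\<And>x y. x \<in> realization V E \<Longrightarrow> y \<in> realization V E \<Longrightarrow> path_metric V E x y \<le> B"
    using assms unfolding T.mbounded_alt by blast
  have "d x y \<le> (2 * C + r) * B + 2 * C" if "x \<in> X" "y \<in> X" for x y
    using lower_bound[OF that] C_nonneg r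
      mult_left_mono[OF B[OF that[THEN quasi_isometry_in]], of "2 * C + r"] by linarith
  then show ?thesis by blast
qed

end

subsection \<open>Hyperbolic spaces of asymptotic dimension one\<close>

lemma (in Metric_space) asdim_at_most_0_if_bounded:
  assumes "\<forall>x\<in>M. \<forall>y\<in>M. d x y \<le> B"
  shows "asdim_at_most M d 0"
proof -
  have "finite {U \<in> {M}. mcball x D \<inter> U \<noteq> {}} \<and> card {U \<in> {M}. mcball x D \<inter> U \<noteq> {}} \<le> 1" for x D
    using card_mono[of "{M}" "{U \<in> {M}. mcball x D \<inter> U \<noteq> {}}"] by auto
  then show ?thesis
    unfolding asdim_at_most_def multiplicity_at_most_def using assms
    by (intro allI impI exI[of _ "{M}"]) auto
qed

lemma (in Metric_space) geodesic_step_exists: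
  assumes "geodesic_space M d" "w \<in> M" "x \<in> M" "0 \<le> r" "r \<le> d w x"
  shows "\<exists>y\<in>M. d x y = r \<and> d w y = d w x - r"
proof -
  obtain \<gamma> where \<gamma>: "\<gamma> 0 = x" "\<gamma> (d x w) = w" "\<gamma> ` {0..d x w} \<subseteq> M"
    "\<forall>s\<in>{0..d x w}. \<forall>t\<in>{0..d x w}. d (\<gamma> s) (\<gamma> t) = \<bar>s - t\<bar>"
    using assms unfolding geodesic_space_def by blast
  have r: "r \<in> {0..d x w}" using assms by (auto simp: commute)
  then have "d (\<gamma> 0) (\<gamma> r) = r" "d (\<gamma> (d x w)) (\<gamma> r) = d x w - r" using \<gamma>(4) by auto
  then show ?thesis using \<gamma> r by (intro bexI[of _ "\<gamma> r"]) (auto simp: commute)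
qed

theorem corollary0p5:
  fixes X :: "'a set" and d :: "'a \<Rightarrow> 'a \<Rightarrow> real"
  assumes "Metric_space X d"
    and "geodesic_space X d"
    and "gromov_hyperbolic X d"
    and "has_asdim X d 1"
  shows "\<exists>(V :: 'a set) E. graph_tree V E \<and>
           \<not> Metric_space.mbounded (realization V E) (path_metric V E) (realization V E) \<and>
           quasi_isometric X d (realization V E) (path_metric V E)"
proof -
  interpret Metric_space X d by fact
  \<comment> \<open>A bounded space is covered by one bounded set and has dimension at most 0.
    Unboundedness also yields a base point.\<close>
  have unbounded: "\<not> (\<forall>x\<in>X. \<forall>y\<in>X. d x y \<le> B)" for B
    using asdim_at_most_0_if_bounded[of B] assms(4) by (auto simp: has_asdim_def)
  then obtain w where w: "w \<in> X" by blast
  obtain \<delta> where \<delta>: "\<delta> \<ge> 0" "\<And>w x y z. \<lbrakk>w \<in> X; x \<in> X; y \<in> X; z \<in> X\<rbrakk> \<Longrightarrow>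
      gromov_product d w x z \<ge> min (gromov_product d w x y) (gromov_product d w y z) - \<delta>"
    using assms(3) unfolding gromov_hyperbolic_def by blast
  \<comment> \<open>The bound \<open>2 * \<delta> \<le> r\<close> is what \<open>\<pi>_close\<close>
    needs; adding 1 keeps \<open>r\<close> positive for \<open>\<delta> = 0\<close>.\<close>
  define r where "r = 2 * \<delta> + 1"
  have r: "r > 0" "2 * \<delta> \<le> r" using \<delta> by (auto simp: r_def)
  have "\<exists>y\<in>X. d x y \<le> r \<and> (d w x \<le> r \<longrightarrow> y = w) \<and> (r < d w x \<longrightarrow> d w y = d w x - r)" if "x \<in> X" for x
  proof (cases "d w x \<le> r")
    case True
    then show ?thesis using w by (intro bexI[of _ w]) (auto simp: commute)
  next
    case False
    then show ?thesis using geodesic_step_exists[OF assms(2) w that, of r] r by force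
  qed
  then obtain \<pi> where \<pi>: "\<And>x. x \<in> X \<Longrightarrow> \<pi> x \<in> X \<and> d x (\<pi> x) \<le> r \<and> (d w x \<le> r \<longrightarrow> \<pi> x = w) \<and>
      (r < d w x \<longrightarrow> d w (\<pi> x) = d w x - r)"
    by metis
  \<comment> \<open>Dimension at most 1 at the scale \<open>D = 2 * r\<close> gives multiplicity 1 +
    1 = 2.\<close>
  have "\<exists>\<O>. \<Union>\<O> = X \<and> (\<exists>C. \<forall>U\<in>\<O>. \<forall>x\<in>U. \<forall>y\<in>U. d x y \<le> C) \<and> multiplicity_at_most X d (2 * r) \<O> 2"
    using assms(4) r unfolding has_asdim_def asdim_at_most_def by (auto dest!: spec[of _ "2 * r"])
  then obtain \<O> C where \<O>: "\<Union>\<O> = X" "\<And>U x y. U \<in> \<O> \<Longrightarrow> x \<in> U \<Longrightarrow> y \<in> U \<Longrightarrow> d x y \<le> C"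
    and mult: "multiplicity_at_most X d (2 * r) \<O> 2"
    by metis
  obtain \<phi> where \<phi>: "\<And>x. x \<in> X \<Longrightarrow> \<phi> x \<in> \<O> \<and> x \<in> \<phi> x" using \<O>(1) Union_iff[of _ \<O>] by metis
  interpret hyperbolic_nerve X d w r C \<phi> \<pi>
  proof
    show "geodesic_space X d" "w \<in> X" "r > 0" by fact+
    show "\<pi> x \<in> X" "d x (\<pi> x) \<le> r" if "x \<in> X" for x using \<pi>[OF that] by auto
    show "\<pi> x = w" if "x \<in> X" "d w x \<le> r" for x using \<pi> that by blast
    show "d w (\<pi> x) = d w x - r" if "x \<in> X" "r < d w x" for x using \<pi> that by blast
    show "d (\<pi> x) y \<le> 2 * r" if "x \<in> X" "y \<in> X" "d w y \<le> d w x" "d x y \<le> 2 * r" for x y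
    proof (cases "d w x \<le> r")
      case True
      then show ?thesis using \<pi>[OF that(1)] that r by simp
    next
      case False
      then have \<pi>x: "\<pi> x \<in> X" "d w (\<pi> x) = d w x - r" "d x (\<pi> x) \<le> r"
        using \<pi>[OF that(1)] by auto
      \<comment> \<open>Whichever product is the minimum, the four-point inequality yields
        \<open>d (\<pi> x) y \<le> r + 2 * \<delta>\<close>, which is at most
        \<open>2 * r\<close>.\<close>
      have "min (gromov_product d w (\<pi> x) x) (gromov_product d w x y) - \<delta>
          \<le> gromov_product d w (\<pi> x) y"
        using \<delta>(2) w \<pi>x(1) that(1,2) by blast
      then show ?thesis
        using \<pi>x(2,3) that(3,4) r
          commute[of w x] commute[of w y] commute[of w "\<pi> x"] commute[of x "\<pi> x"]
        by (cases "gromov_product d w (\<pi> x) x \<le> gromov_product d w x y")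
          (simp_all add: gromov_product_def min_def field_simps)
    qed
    show "d x y \<le> C" if "x \<in> X" "y \<in> X" "\<phi> x = \<phi> y" for x y using that \<phi> \<O>(2) by metis
    show "\<phi> x = \<phi> y \<or> \<phi> y = \<phi> z \<or> \<phi> x = \<phi> z"
      if "x \<in> X" "y \<in> X" "z \<in> X" "d x y \<le> 2 * r" "d x z \<le> 2 * r" for x y z
    proof (rule ccontr)
      assume "\<not> ?thesis"
      \<comment> \<open>Three distinct colours would be three members of the covering that meet the
        closed \<open>2 * r\<close>-ball around \<open>x\<close>.\<close>
      then have "card {\<phi> x, \<phi> y, \<phi> z} = 3" by auto
      moreover let ?S = "{U \<in> \<O>. mcball x (2 * r) \<inter> U \<noteq> {}}"
      have "{\<phi> x, \<phi> y, \<phi> z} \<subseteq> ?S"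
        using \<phi> that r by (fastforce simp: in_mcball)
      moreover have "finite ?S" "card ?S \<le> 2"
        using mult that(1) unfolding multiplicity_at_most_def by auto
      ultimately show False using card_mono[of ?S "{\<phi> x, \<phi> y, \<phi> z}"] by linarith
    qed
  qed
  have "\<not> T.mbounded (realization V E)" using bounded_if_tree_bounded unbounded by blast
  then show ?thesis using tree quasi_isometric_tree by blast
qed

end
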